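(* Let $A$ be a conjugacy class of a finite group $G$ such that $AA^{-1}=\{1\}\cup A\cup A^{-1}$. Then $\langle A\rangle = AA^{-1}$, and this is an elementary abelian group.
   Context: For subsets $A,B$ of a group $G$, $AB=\{ab : a\in A,\ b\in B\}$ is the product set, $A^{-1}=\{a^{-1} : a\in A\}$, and $\langle A\rangle$ is the subgroup of $G$ generated by $A$. A finite group is elementary abelian if, for some prime $p$, it is abelian and every element $x$ satisfies $x^p=1$ (the trivial group is included). *)

theory Defs
  imports
    "HOL-Algebra.Group_Action"
    "HOL-Algebra.Generated_Groups"
    "HOL-Computational_Algebra.Primes"
begin

definition conjugacy_classes :: "('a, 'b) monoid_scheme \<Rightarrow> 'a set set" where
  "conjugacy_classes G =
     orbits G (carrier G) (\<lambda>g. \<lambda>x \<in> carrier G. g \<otimes>\<^bsub>G\<^esub> x \<otimes>\<^bsub>G\<^esub> inv\<^bsub>G\<^esub> g)"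

definition elementary_abelian :: "('a, 'b) monoid_scheme \<Rightarrow> bool" where
  "elementary_abelian H \<longleftrightarrow>
     comm_group H \<and> finite (carrier H) \<and>
     (\<exists>p::nat. prime p \<and> (\<forall>x \<in> carrier H. x [^]\<^bsub>H\<^esub> p = \<one>\<^bsub>H\<^esub>))"

end

theory Submission
  imports Defs "HOL-Algebra.Sylow" "HOL-Algebra.Multiplicative_Group"
begin

text \<open>
Write \<open>H = {1} \<union> A \<union> A\<inverse>\<close>, so that \<open>A A\<inverse> = H\<close>.  Once \<open>H\<close> is known to be a subgroup, the rest is
short: any two nontrivial elements of \<open>H\<close> are conjugate up to inversion, so they all have the same
order, which must be a prime \<open>p\<close> unless \<open>H\<close> is trivial; by Cauchy's theorem \<open>H\<close> is a \<open>p\<close>-group, so its centre is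
nontrivial; the centre is invariant under conjugation in the whole group, hence contains \<open>A\<close>, and
\<open>H\<close> is abelian.

The difficulty is to show \<open>A A \<subseteq> H\<close>.  Since \<open>A\<inverse> A = H\<close>, any two distinct elements \<open>a\<close>, \<open>b\<close> of
\<open>A\<close> are joined by an arrow: \<open>a \<rightarrow> b\<close> if \<open>a\<inverse> b \<in> A\<close>, or \<open>b \<rightarrow> a\<close>.  Conjugation acts on this
finite digraph transitively, and this makes it strongly connected (lemma \<open>strongly_connected\<close>).  Now
suppose that \<open>q \<in> A A\<close> lies outside \<open>H\<close>, and consider the set of \<open>a \<in> A\<close> with \<open>a\<inverse> q \<in> A\<close>.  It is
nonempty, and it is closed under arrows: if \<open>a\<inverse> q\<close> and \<open>a\<inverse> b\<close> are both in \<open>A\<close>, then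
\<open>q\<inverse> b \<in> A\<inverse> A = H\<close>, and the cases \<open>b = q\<close> and \<open>q\<inverse> b \<in> A\<close> would put \<open>q\<close> into \<open>H\<close>.
By strong connectedness it is all of \<open>A\<close> (lemma \<open>exotic_factor\<close>).  So \<open>A\<inverse> q = A\<close>.

This rigidity is contradictory.  No nontrivial element stabilises \<open>A\<close> by translation, so \<open>q\<close> is
unique, hence central, and \<open>q\<^sup>2 = 1\<close>.  Each \<open>x \<in> A\<close> is conjugate to \<open>x\<inverse> q\<close>; comparing orders
gives \<open>x\<^sup>2 = q\<close> (lemma \<open>exotic_square\<close>).  For \<open>x, y \<in> A\<close> the product \<open>x y\<close> lies in \<open>H \<union> {q}\<close>, and
either \<open>x = y\<close> or \<open>(x y)\<^sup>2 = q\<close>; the latter says that \<open>y\<close> conjugates \<open>x\<close> to \<open>x\<inverse>\<close>, which is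
impossible as \<open>A\<close> and \<open>A\<inverse>\<close> are disjoint.  So \<open>A\<close> is a singleton, \<open>H = A A\<inverse> = {1}\<close>, and then
\<open>A = {1}\<close>, whose only product is \<open>1 \<in> H\<close>.
\<close>

section \<open>Groups of prime power order\<close>

lemma (in group_action) card_orbit_prime_power:
  assumes "finite (carrier G)" "order G = p ^ n" "prime p" "x \<in> E" "card (orbit G \<phi> x) \<noteq> 1"
  shows "p dvd card (orbit G \<phi> x)"
proof -
  have "card (orbit G \<phi> x) dvd p ^ n"
    using orbit_stabilizer_theorem[OF assms(4)] assms(2) by (metis dvd_triv_left)
  then obtain i where "card (orbit G \<phi> x) = p ^ i"
    using divides_primepow_nat[OF assms(3)] by blast
  with assms(5) show ?thesis by (cases i) auto
qed

text \<open>
The class equation: if no nontrivial element were central, every conjugacy class other than \<open>{1}\<close>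
would have size divisible by \<open>p\<close>, and the order of the group would be \<open>1\<close> modulo \<open>p\<close>.
\<close>
lemma (in group) p_group_nontrivial_centre:
  assumes fin: "finite (carrier G)" and ord: "order G = p ^ n" and p: "prime p"
    and nontriv: "carrier G \<noteq> {\<one>}"
  shows "\<exists>z\<in>carrier G. z \<noteq> \<one> \<and> (\<forall>g\<in>carrier G. g \<otimes> z = z \<otimes> g)"
proof (rule ccontr)
  assume no_centre: "\<not> ?thesis"
  define \<phi> where "\<phi> = (\<lambda>g. \<lambda>h\<in>carrier G. g \<otimes> h \<otimes> inv g)"
  interpret group_action G "carrier G" \<phi>
    unfolding \<phi>_def by (rule action_by_conjugation)
  let ?O = "orbits G (carrier G) \<phi>"
  have finO: "finite ?O"
    using fin by (simp add: orbits_def Setcompr_eq_image)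
  have orbit_one: "orbit G \<phi> \<one> = {\<one>}"
    unfolding orbit_def \<phi>_def by force
  then have oneO: "{\<one>} \<in> ?O"
    unfolding orbits_def by blast
  have "p dvd card c" if "c \<in> ?O - {{\<one>}}" for c
  proof -
    from that obtain x where x: "x \<in> carrier G" "c = orbit G \<phi> x" "c \<noteq> {\<one>}"
      unfolding orbits_def by blast
    with orbit_one have "x \<noteq> \<one>" by blast
    with no_centre x obtain g where g: "g \<in> carrier G" "g \<otimes> x \<noteq> x \<otimes> g" by blast
    have "\<phi> g x \<noteq> x"
      using g x unfolding \<phi>_def by (simp add: inv_solve_right')
    moreover have "\<phi> g x \<in> c" "x \<in> c"
      using g x orbit_refl unfolding orbit_def by auto
    ultimately have "card c \<noteq> 1"
      by (metis card_1_singletonE singletonD)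
    then show ?thesis
      using card_orbit_prime_power[OF fin ord p] x by blast
  qed
  then have "p dvd (\<Sum>c\<in>?O - {{\<one>}}. card c)"
    by (rule dvd_sum)
  moreover have "order G = (\<Sum>c\<in>?O. card c)"
    using disjoint_sum[OF fin, of "\<lambda>_. 1::nat"] by (simp add: order_def)
  then have "order G = 1 + (\<Sum>c\<in>?O - {{\<one>}}. card c)"
    using sum.remove[OF finO oneO, of card] by simp
  moreover have "order G \<noteq> 1"
    using nontriv order_one_triv_iff by blast
  then have "p dvd order G"
    using ord by (cases n) auto
  ultimately have "p dvd 1"
    by (metis dvd_add_left_iff)
  with p show False by simp
qed

text \<open>
Cauchy's theorem.  Sylow's theorem, applied to the first power of \<open>r\<close>, yields a subgroup of order
\<open>r\<close>, in which every nontrivial element has order \<open>r\<close>.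
\<close>
lemma (in group) exists_ord_prime:
  assumes fin: "finite (carrier G)" and r: "prime r" "r dvd order G"
  shows "\<exists>x\<in>carrier G. ord x = r"
proof -
  obtain m where "order G = r ^ 1 * m"
    using r(2) by auto
  then obtain K where K: "subgroup K G" "card K = r"
    using sylow_thm[OF r(1) is_group _ fin, of 1 m] by auto
  have "K \<noteq> {\<one>}"
    using K r(1) by auto
  then obtain x where x: "x \<in> K" "x \<noteq> \<one>"
    using subgroup.one_closed[OF K(1)] by blast
  have xG: "x \<in> carrier G"
    using K(1) x(1) subgroup.mem_carrier by metis
  interpret K: group "G\<lparr>carrier := K\<rparr>"
    using K(1) subgroup_imp_group by blast
  have "x [^] r = \<one>"
    using K.pow_order_eq_1[of x] x(1) K(2) nat_pow_consistent[of x r K] by (simp add: order_def)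
  then have "ord x dvd r"
    using pow_eq_id[OF xG] by blast
  moreover have "ord x \<noteq> 1"
    using ord_eq_1[OF xG] x(2) by blast
  ultimately have "ord x = r"
    using r(1) prime_nat_iff by blast
  with xG show ?thesis by blast
qed

lemma (in group) order_prime_power:
  assumes fin: "finite (carrier G)" and p: "prime p"
    and exp: "\<And>x. x \<in> carrier G \<Longrightarrow> x [^] p = \<one>"
  shows "\<exists>n. order G = p ^ n"
proof -
  have "r = p" if r: "prime r" "r dvd order G" for r
  proof -
    obtain x where x: "x \<in> carrier G" "ord x = r"
      using exists_ord_prime[OF fin r] by blast
    then have "r dvd p"
      using pow_eq_id exp by metis
    with r(1) p show ?thesis
      by (simp add: primes_dvd_imp_eq)
  qed
  moreover have pos: "order G \<noteq> 0"
    using fin order_gt_0_iff_finite by simp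
  obtain m where m: "order G = p ^ multiplicity p (order G) * m" "\<not> p dvd m"
    using multiplicity_decompose'[of "order G" p] pos p by (metis not_prime_unit)
  ultimately have "m = 1"
    by (metis dvd_triv_right dvd_trans prime_factor_nat)
  with m show ?thesis by auto
qed

section \<open>Conjugacy classes\<close>

lemma (in group) inv_cancel:
  assumes "x \<in> carrier G" "y \<in> carrier G"
  shows "inv x \<otimes> (x \<otimes> y) = y" "x \<otimes> (inv x \<otimes> y) = y"
    "y \<otimes> x \<otimes> inv x = y" "y \<otimes> inv x \<otimes> x = y"
  using assms by (metis inv_closed l_inv l_one m_assoc) (use assms in \<open>metis inv_closed r_inv l_one m_assoc\<close>,
      use assms in \<open>simp_all add: m_assoc\<close>)

lemma (in group) conjugacy_classE:
  assumes "A \<in> conjugacy_classes G"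
  obtains x where "x \<in> carrier G" "A = {g \<otimes> x \<otimes> inv g |g. g \<in> carrier G}"
  using assms unfolding conjugacy_classes_def orbits_def orbit_def by auto

lemma (in group) conjugacy_class_subset: "A \<in> conjugacy_classes G \<Longrightarrow> A \<subseteq> carrier G"
  by (erule conjugacy_classE) auto

lemma (in group) conjugacy_class_nonempty: "A \<in> conjugacy_classes G \<Longrightarrow> A \<noteq> {}"
  by (erule conjugacy_classE) auto

lemma (in group) conjugacy_class_conj_closed:
  assumes "A \<in> conjugacy_classes G" and g: "g \<in> carrier G" and a: "a \<in> A"
  shows "g \<otimes> a \<otimes> inv g \<in> A"
proof -
  obtain x where x: "x \<in> carrier G" "A = {g \<otimes> x \<otimes> inv g |g. g \<in> carrier G}"
    using assms(1) by (rule conjugacy_classE)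
  obtain h where h: "h \<in> carrier G" "a = h \<otimes> x \<otimes> inv h"
    using a x(2) by blast
  have "g \<otimes> a \<otimes> inv g = (g \<otimes> h) \<otimes> x \<otimes> inv (g \<otimes> h)"
    using g h x(1) by (simp add: inv_mult_group m_assoc)
  then show ?thesis
    using x(2) g h(1) by blast
qed

lemma (in group) conjugacy_class_transitive:
  assumes "A \<in> conjugacy_classes G" and a: "a \<in> A" and b: "b \<in> A"
  shows "\<exists>g\<in>carrier G. b = g \<otimes> a \<otimes> inv g"
proof -
  obtain x where x: "x \<in> carrier G" "A = {g \<otimes> x \<otimes> inv g |g. g \<in> carrier G}"
    using assms(1) by (rule conjugacy_classE)
  obtain h where h: "h \<in> carrier G" "a = h \<otimes> x \<otimes> inv h"
    using a x(2) by blast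
  obtain k where k: "k \<in> carrier G" "b = k \<otimes> x \<otimes> inv k"
    using b x(2) by blast
  have "b = (k \<otimes> inv h) \<otimes> a \<otimes> inv (k \<otimes> inv h)"
    using h k x(1) by (simp add: inv_mult_group m_assoc inv_cancel)
  then show ?thesis
    using h(1) k(1) by blast
qed

section \<open>The arrow relation on the class\<close>

text \<open>
The hypotheses of the theorem, with the conjugacy class described intrinsically: a nonempty set on
which the group acts transitively by conjugation.
\<close>
locale small_quotient_class = group +
  fixes A :: "'a set"
  assumes fin: "finite (carrier G)"
    and sub: "A \<subseteq> carrier G"
    and nonempty: "A \<noteq> {}"
    and conj_closed: "\<lbrakk>g \<in> carrier G; a \<in> A\<rbrakk> \<Longrightarrow> g \<otimes> a \<otimes> inv g \<in> A"
    and conj_transitive: "\<lbrakk>a \<in> A; b \<in> A\<rbrakk> \<Longrightarrow> \<exists>g\<in>carrier G. b = g \<otimes> a \<otimes> inv g"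
    and quotients: "A <#> (set_inv A) = {\<one>} \<union> A \<union> (set_inv A)"
begin

definition H :: "'a set" where "H = {\<one>} \<union> A \<union> (set_inv A)"

lemma mem_carrier [simp]: "a \<in> A \<Longrightarrow> a \<in> carrier G"
  using sub by blast

lemmas [simp] = inv_cancel

lemma mem_set_inv: "h \<in> set_inv A \<longleftrightarrow> h \<in> carrier G \<and> inv h \<in> A"
proof
  assume "h \<in> carrier G \<and> inv h \<in> A"
  then show "h \<in> set_inv A"
    unfolding SET_INV_def using inv_inv[of h] by (metis UN_iff singletonI)
qed (auto simp: SET_INV_def)

lemma H_iff: "h \<in> H \<longleftrightarrow> h \<in> carrier G \<and> (h = \<one> \<or> h \<in> A \<or> inv h \<in> A)"
  unfolding H_def by (auto simp: mem_set_inv)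

lemma H_eq_quotients: "H = {a \<otimes> inv b |a b. a \<in> A \<and> b \<in> A}"
proof -
  have "H = A <#> (set_inv A)"
    unfolding H_def using quotients by simp
  then show ?thesis
    unfolding set_mult_def SET_INV_def by auto
qed

lemma quotient_in_H: "\<lbrakk>a \<in> A; b \<in> A\<rbrakk> \<Longrightarrow> a \<otimes> inv b \<in> H"
  unfolding H_eq_quotients by blast

lemma conj_iff:
  assumes "g \<in> carrier G" "h \<in> carrier G"
  shows "g \<otimes> h \<otimes> inv g \<in> A \<longleftrightarrow> h \<in> A"
proof
  assume "g \<otimes> h \<otimes> inv g \<in> A"
  from conj_closed[OF _ this, of "inv g"] assms show "h \<in> A"
    by (simp add: m_assoc)
qed (use assms conj_closed in blast)

lemma inv_conj: "\<lbrakk>g \<in> carrier G; h \<in> carrier G\<rbrakk> \<Longrightarrow> inv (g \<otimes> h \<otimes> inv g) = g \<otimes> inv h \<otimes> inv g"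
  by (simp add: inv_mult_group m_assoc)

lemma H_conj:
  assumes "g \<in> carrier G" "h \<in> carrier G"
  shows "g \<otimes> h \<otimes> inv g \<in> H \<longleftrightarrow> h \<in> H"
proof -
  have "g \<otimes> h \<otimes> inv g = \<one> \<longleftrightarrow> h = \<one>"
    using assms by (simp add: inv_solve_right')
  then show ?thesis
    using assms conj_iff inv_conj[OF assms] by (simp add: H_iff)
qed

lemma mult_comm_iff:
  assumes "x \<in> carrier G" "y \<in> carrier G"
  shows "x \<otimes> y \<in> A \<longleftrightarrow> y \<otimes> x \<in> A"
  using conj_iff[of x "y \<otimes> x"] assms by (simp add: m_assoc)

text \<open>
The elements \<open>b a\<inverse>\<close> and \<open>a\<inverse> b\<close> are conjugate, so the hypothesis on \<open>A A\<inverse>\<close> also controls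
\<open>A\<inverse> A\<close>.  In graph terms: two distinct elements of \<open>A\<close> are always joined by an arrow.
\<close>
lemma left_quotient_cases:
  assumes "a \<in> A" "b \<in> A"
  obtains "a = b" | "inv a \<otimes> b \<in> A" | "inv b \<otimes> a \<in> A"
proof -
  have "b \<otimes> inv a \<in> H"
    using quotient_in_H assms by simp
  then consider "b \<otimes> inv a = \<one>" | "b \<otimes> inv a \<in> A" | "a \<otimes> inv b \<in> A"
    using assms by (auto simp: H_iff inv_mult_group)
  then show thesis
  proof cases
    case 1
    with assms have "a = b" by (simp add: inv_solve_right')
    then show thesis by (rule that(1))
  next
    case 2
    then have "inv a \<otimes> b \<in> A"
      using assms mult_comm_iff[of b "inv a"] by simp
    then show thesis by (rule that(2))
  next
    case 3
    then have "inv b \<otimes> a \<in> A"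
      using assms mult_comm_iff[of a "inv b"] by simp
    then show thesis by (rule that(3))
  qed
qed

definition beats :: "('a \<times> 'a) set" where
  "beats = {(a, b). a \<in> A \<and> b \<in> A \<and> inv a \<otimes> b \<in> A}"

lemma beats_conj:
  assumes "g \<in> carrier G" "(a, b) \<in> beats"
  shows "(g \<otimes> a \<otimes> inv g, g \<otimes> b \<otimes> inv g) \<in> beats"
proof -
  have ab: "a \<in> A" "b \<in> A" "inv a \<otimes> b \<in> A"
    using assms(2) unfolding beats_def by auto
  have "inv (g \<otimes> a \<otimes> inv g) \<otimes> (g \<otimes> b \<otimes> inv g) = g \<otimes> (inv a \<otimes> b) \<otimes> inv g"
    using ab assms(1) by (simp add: inv_mult_group m_assoc)
  then show ?thesis
    using ab assms(1) conj_closed unfolding beats_def by simp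
qed

lemma reachable_conj:
  assumes "g \<in> carrier G" "(a, b) \<in> beats\<^sup>*"
  shows "(g \<otimes> a \<otimes> inv g, g \<otimes> b \<otimes> inv g) \<in> beats\<^sup>*"
  using assms(2)
proof induction
  case (step b c)
  then show ?case
    using beats_conj[OF assms(1) step(2)] by (meson rtrancl_into_rtrancl)
qed simp

lemma reachable_in_class: "\<lbrakk>a \<in> A; (a, b) \<in> beats\<^sup>*\<rbrakk> \<Longrightarrow> b \<in> A"
  by (erule rtranclE) (auto simp: beats_def)

text \<open>
Conjugation by an element taking \<open>a\<close> to \<open>b\<close> embeds the set reachable from \<open>a\<close> into the one
reachable from \<open>b\<close>.
\<close>
lemma card_reachable_le:
  assumes "a \<in> A" "b \<in> A"
  shows "card (beats\<^sup>* `` {a}) \<le> card (beats\<^sup>* `` {b})"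
proof -
  obtain g where g: "g \<in> carrier G" "b = g \<otimes> a \<otimes> inv g"
    using conj_transitive assms by blast
  have reach_sub: "beats\<^sup>* `` {c} \<subseteq> carrier G" if "c \<in> A" for c
    using reachable_in_class[OF that] by auto
  show ?thesis
  proof (rule card_inj_on_le[where f = "\<lambda>h. g \<otimes> h \<otimes> inv g"])
    show "inj_on (\<lambda>h. g \<otimes> h \<otimes> inv g) (beats\<^sup>* `` {a})"
      using conjugation_is_inj[OF g(1)] reach_sub[OF assms(1)] by (meson inj_onI subsetD)
    show "(\<lambda>h. g \<otimes> h \<otimes> inv g) ` (beats\<^sup>* `` {a}) \<subseteq> beats\<^sup>* `` {b}"
      using reachable_conj[OF g(1)] g(2) by auto
    show "finite (beats\<^sup>* `` {b})"
      using reach_sub[OF assms(2)] fin finite_subset by blast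
  qed
qed

text \<open>
If \<open>b \<rightarrow> a\<close>, then everything reachable from \<open>a\<close> is reachable from \<open>b\<close>; as both sets have the same
size they coincide, so \<open>b\<close> is reachable from \<open>a\<close>, against the arrow.
\<close>
lemma strongly_connected:
  assumes "a \<in> A" "b \<in> A"
  shows "(a, b) \<in> beats\<^sup>*"
  using assms
proof (cases rule: left_quotient_cases)
  case 3
  then have "(b, a) \<in> beats"
    using assms by (simp add: beats_def)
  then have "beats\<^sup>* `` {a} \<subseteq> beats\<^sup>* `` {b}"
    by (auto intro: converse_rtrancl_into_rtrancl)
  moreover have "finite (beats\<^sup>* `` {b})"
    using reachable_in_class[OF assms(2)] finite_subset[OF _ fin] by (metis Image_singleton_iff mem_carrier subsetI)
  ultimately have "beats\<^sup>* `` {a} = beats\<^sup>* `` {b}"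
    using card_reachable_le assms by (meson card_seteq)
  then show ?thesis by auto
qed (use assms in \<open>auto simp: beats_def\<close>)

text \<open>
An element \<open>d\<close> stabilising \<open>A\<close> is of the form \<open>a\<inverse> (a d) \<in> A\<inverse> A\<close>, so if it is nontrivial, it or its
inverse lies in \<open>A\<close>.  Translating that element back by \<open>d\<inverse>\<close> or \<open>d\<close> would give \<open>1 \<in> A\<close>.
\<close>
lemma stabilizer_trivial:
  assumes one: "\<one> \<notin> A" and d: "d \<in> carrier G" "\<And>a. a \<in> A \<Longrightarrow> a \<otimes> d \<in> A"
  shows "d = \<one>"
proof -
  have surj: "(\<lambda>a. a \<otimes> d) ` A = A"
  proof (rule endo_inj_surj)
    show "finite A"
      using fin sub finite_subset by blast
    show "inj_on (\<lambda>a. a \<otimes> d) A"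
      using d(1) by (auto intro!: inj_onI)
  qed (use d in auto)
  have d_inv: "a \<otimes> inv d \<in> A" if a: "a \<in> A" for a
  proof -
    obtain b where "b \<in> A" "a = b \<otimes> d"
      using surj a by blast
    then show ?thesis using d(1) by simp
  qed
  obtain a where a: "a \<in> A"
    using nonempty by blast
  consider "d = \<one>" | "d \<in> A" | "inv d \<in> A"
    using a d(2)[OF a] by (rule left_quotient_cases) (use a d(1) in \<open>auto simp: inv_mult_group m_assoc\<close>)
  then show ?thesis
  proof cases
    case 2
    have "d \<otimes> inv d \<in> A" by (rule d_inv[OF 2])
    with one d show ?thesis by simp
  next
    case 3
    have "inv d \<otimes> d \<in> A" by (rule d(2)[OF 3])
    with one d show ?thesis by simp
  qed simp
qed

section \<open>Products of two elements of the class\<close>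

text \<open>
The obstructions to \<open>H\<close> being a subgroup.  The lemmas below derive ever stronger properties of such
an element until none can exist (lemma \<open>exotic_empty\<close>).
\<close>
definition exotic :: "'a set" where
  "exotic = {q. q \<notin> H \<and> (\<exists>a\<in>A. \<exists>b\<in>A. q = a \<otimes> b)}"

lemma exotic_carrier [simp]: "q \<in> exotic \<Longrightarrow> q \<in> carrier G"
  unfolding exotic_def by auto

lemma exotic_not_H: "q \<in> exotic \<Longrightarrow> q \<notin> H"
  unfolding exotic_def by auto

lemma product_cases: "\<lbrakk>a \<in> A; b \<in> A\<rbrakk> \<Longrightarrow> a \<otimes> b \<in> H \<or> a \<otimes> b \<in> exotic"
  unfolding exotic_def by auto

text \<open>
If \<open>A\<close> met \<open>A\<inverse>\<close>, the two classes would be equal, and \<open>A A = A A\<inverse> = H\<close> would leave no room for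
\<open>q\<close>.
\<close>
lemma exotic_inv_notin:
  assumes q: "q \<in> exotic" and x: "x \<in> A"
  shows "inv x \<notin> A"
proof
  assume "inv x \<in> A"
  obtain a b where ab: "a \<in> A" "b \<in> A" "q = a \<otimes> b"
    using q unfolding exotic_def by auto
  obtain g where g: "g \<in> carrier G" "b = g \<otimes> x \<otimes> inv g"
    using conj_transitive x ab(2) by blast
  have "inv b \<in> A"
    using g x conj_closed[OF g(1) \<open>inv x \<in> A\<close>] inv_conj by simp
  from quotient_in_H[OF ab(1) this] ab exotic_not_H[OF q] show False
    by simp
qed

lemma exotic_one_notin: "q \<in> exotic \<Longrightarrow> \<one> \<notin> A"
  using exotic_inv_notin[of q \<one>] by auto

text \<open>
The left factors of \<open>q\<close> in \<open>A\<close> are closed under arrows.  Both \<open>a\<inverse> b\<close> and \<open>a\<inverse> q\<close> lie in \<open>A\<close>, so they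
are equal or joined by an arrow; only the arrow that makes \<open>b\<close> a left factor of \<open>q\<close> avoids
\<open>q \<in> H\<close>.
\<close>
lemma exotic_factor_step:
  assumes q: "q \<in> exotic" and a: "inv a \<otimes> q \<in> A" and beat: "(a, b) \<in> beats"
  shows "inv b \<otimes> q \<in> A"
proof -
  have ab: "a \<in> A" "b \<in> A" "inv a \<otimes> b \<in> A"
    using beat unfolding beats_def by auto
  from ab(3) a show ?thesis
  proof (cases rule: left_quotient_cases)
    case 1
    then have "b = q"
      using ab q by simp
    with ab exotic_not_H[OF q] show ?thesis
      by (simp add: H_iff)
  next
    case 2
    then show ?thesis
      using ab q by (simp add: inv_mult_group m_assoc)
  next
    case 3
    then have "inv q \<otimes> b \<in> A"
      using ab q by (simp add: inv_mult_group m_assoc)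
    moreover have "b \<otimes> inv (inv q \<otimes> b) = q"
      using ab q by (simp add: inv_mult_group)
    ultimately show ?thesis
      using quotient_in_H[OF ab(2), of "inv q \<otimes> b"] exotic_not_H[OF q] by simp
  qed
qed

text \<open>
Some element of \<open>A\<close> is a left factor of \<open>q\<close>, and every other one can be reached from it along arrows.
\<close>
lemma exotic_factor:
  assumes q: "q \<in> exotic" and a: "a \<in> A"
  shows "inv a \<otimes> q \<in> A"
proof -
  obtain s t where st: "s \<in> A" "t \<in> A" "q = s \<otimes> t"
    using q unfolding exotic_def by auto
  have "(s, a) \<in> beats\<^sup>*"
    using strongly_connected st(1) a by blast
  then show ?thesis
  proof induction
    case base
    then show ?case using st by simp
  next
    case (step b c)
    then show ?case using exotic_factor_step[OF q] by blast
  qed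
qed

text \<open>
The map \<open>a \<mapsto> a\<inverse> q\<close> sends \<open>A\<close> into itself for each exotic \<open>q\<close>.  Composing the maps of two exotic
elements and conjugating gives the translation by \<open>q' q\<inverse>\<close>, which must be trivial.
\<close>
lemma exotic_unique:
  assumes q: "q \<in> exotic" "q' \<in> exotic"
  shows "q' = q"
proof -
  have "a \<otimes> (q' \<otimes> inv q) \<in> A" if a: "a \<in> A" for a
  proof -
    have "inv (inv a \<otimes> q) \<otimes> q' \<in> A"
      using exotic_factor q a by blast
    then have "q \<otimes> (inv (inv a \<otimes> q) \<otimes> q') \<otimes> inv q \<in> A"
      using conj_closed q by simp
    then show ?thesis
      using a q by (simp add: inv_mult_group m_assoc)
  qed
  then have "q' \<otimes> inv q = \<one>"
    using stabilizer_trivial exotic_one_notin q by simp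
  then show ?thesis
    using q by (simp add: inv_solve_right')
qed

text \<open>Conjugates of exotic elements are exotic, so uniqueness makes \<open>q\<close> central.\<close>
lemma exotic_central:
  assumes q: "q \<in> exotic" and g: "g \<in> carrier G"
  shows "g \<otimes> q = q \<otimes> g"
proof -
  obtain a b where ab: "a \<in> A" "b \<in> A" "q = a \<otimes> b"
    using q unfolding exotic_def by auto
  have "g \<otimes> q \<otimes> inv g = (g \<otimes> a \<otimes> inv g) \<otimes> (g \<otimes> b \<otimes> inv g)"
    using ab g by (simp add: m_assoc)
  moreover have "g \<otimes> q \<otimes> inv g \<notin> H"
    using H_conj g q exotic_not_H by simp
  ultimately have "g \<otimes> q \<otimes> inv g \<in> exotic"
    unfolding exotic_def using conj_closed[OF g] ab by blast
  then have "g \<otimes> q \<otimes> inv g = q"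
    using exotic_unique q by blast
  then show ?thesis
    using q g by (simp add: inv_solve_right')
qed

text \<open>
Writing \<open>x = a b\<inverse>\<close> with \<open>a, b \<in> A\<close> gives \<open>q x = a (b\<inverse> q)\<close>, again a product of two elements of \<open>A\<close>,
so \<open>q x\<close> lies in \<open>H\<close> or equals \<open>q\<close>.  All possibilities except \<open>q x \<in> A\<inverse>\<close> contradict \<open>q \<notin> H\<close> or
\<open>1 \<notin> A\<close>.
\<close>
lemma exotic_translate:
  assumes q: "q \<in> exotic" and x: "x \<in> A"
  shows "inv (q \<otimes> x) \<in> A"
proof -
  have "x \<in> H"
    using x by (simp add: H_iff)
  then obtain a b where ab: "a \<in> A" "b \<in> A" "x = a \<otimes> inv b"
    unfolding H_eq_quotients by blast
  have "q \<otimes> x = a \<otimes> (inv b \<otimes> q)"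
    using exotic_central[OF q, of x] ab q by (simp add: m_assoc)
  then consider "q \<otimes> x \<in> H" | "q \<otimes> x \<in> exotic"
    using product_cases ab(1) exotic_factor[OF q ab(2)] by metis
  then show ?thesis
  proof cases
    case 1
    have "q \<otimes> x \<noteq> \<one>"
    proof
      assume "q \<otimes> x = \<one>"
      then have "q = inv x"
        using q x by (simp add: inv_equality)
      with x exotic_not_H[OF q] show False
        by (simp add: H_iff)
    qed
    moreover have "q \<otimes> x \<notin> A"
      using quotient_in_H[of "q \<otimes> x" x] q x exotic_not_H[OF q] by auto
    ultimately show ?thesis
      using 1 by (simp add: H_iff)
  next
    case 2
    then have "q \<otimes> x = q"
      using exotic_unique q by blast
    then have "x = \<one>"
      using q x by simp
    with x q exotic_one_notin show ?thesis by blast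
  qed
qed

text \<open>
Multiplication by \<open>q\<close> maps \<open>A\<close> into \<open>A\<inverse>\<close> and \<open>A\<inverse>\<close> into \<open>A\<close>, so \<open>q\<^sup>2\<close> stabilises \<open>A\<close>.
\<close>
lemma exotic_involution:
  assumes q: "q \<in> exotic"
  shows "q \<otimes> q = \<one>"
proof -
  have "x \<otimes> (q \<otimes> q) \<in> A" if x: "x \<in> A" for x
  proof -
    have "inv (inv (q \<otimes> x)) \<otimes> q \<in> A"
      using exotic_factor[OF q exotic_translate[OF q x]] .
    then show ?thesis
      using x q exotic_central[OF q, of x] by (simp flip: m_assoc)
  qed
  then show ?thesis
    using stabilizer_trivial exotic_one_notin[OF q] q by simp
qed

lemma ord_conj:
  assumes "g \<in> carrier G" "x \<in> carrier G"
  shows "ord (g \<otimes> x \<otimes> inv g) = ord x"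
proof -
  have pow: "(g \<otimes> x \<otimes> inv g) [^] n = g \<otimes> x [^] n \<otimes> inv g" for n :: nat
    using assms by (induction n) (simp_all add: m_assoc)
  have "(g \<otimes> x \<otimes> inv g) [^] n = \<one> \<longleftrightarrow> x [^] n = \<one>" for n :: nat
    using assms by (simp add: pow inv_solve_right')
  then show ?thesis
    using assms by (simp add: ord_unique pow_eq_id)
qed

lemma ord_class: "\<lbrakk>a \<in> A; b \<in> A\<rbrakk> \<Longrightarrow> ord a = ord b"
  using conj_transitive[of a b] ord_conj by force

text \<open>
Otherwise \<open>x\<^sup>2\<close> is a nontrivial element of \<open>H\<close>, so it has the same order \<open>n\<close> as \<open>x\<close>, which forces
\<open>n\<close> to be odd.  But \<open>x\<close> is also conjugate to \<open>x\<inverse> q\<close>, where \<open>q\<close> is a central involution, and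
\<open>(x\<inverse> q)\<^sup>n = q\<close> for odd \<open>n\<close>.
\<close>
lemma exotic_square:
  assumes q: "q \<in> exotic" and x: "x \<in> A"
  shows "x \<otimes> x = q"
proof (rule ccontr)
  assume "x \<otimes> x \<noteq> q"
  then have "x \<otimes> x \<in> H"
    using product_cases[OF x x] exotic_unique q by blast
  moreover have "x \<otimes> x \<noteq> \<one>"
    using exotic_inv_notin[OF q x] x inv_equality[of x x] by auto
  ultimately consider "x \<otimes> x \<in> A" | "inv (x \<otimes> x) \<in> A"
    by (auto simp: H_iff)
  then have ord_sq: "ord (x \<otimes> x) = ord x"
    using ord_class[OF x] x by cases (metis, metis ord_inv m_closed mem_carrier)
  have "odd (ord x)"
  proof
    assume "even (ord x)"
    then obtain k where k: "ord x = 2 * k" by blast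
    have "(x \<otimes> x) [^] k = x [^] (2 * k)"
      using x nat_pow_pow[of x 2 k] by (simp add: numeral_2_eq_2)
    also have "\<dots> = \<one>"
      using k x by (metis mem_carrier pow_ord_eq_1)
    finally have "2 * k dvd k"
      using pow_eq_id[of "x \<otimes> x" k] x ord_sq k by simp
    then have "k = 0" by (cases k) (auto dest: dvd_imp_le)
    with k ord_ge_1[OF fin, of x] x show False by simp
  qed
  then obtain k where k: "ord x = Suc (2 * k)"
    by (metis oddE Suc_eq_plus1)
  have "q [^] (2 * k) = \<one>"
    using exotic_involution[OF q] q nat_pow_pow[of q 2 k] by (simp add: numeral_2_eq_2)
  then have q_pow: "q [^] ord x = q"
    using k q by simp
  have y: "inv x \<otimes> q \<in> A"
    by (rule exotic_factor[OF q x])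
  then have "\<one> = (inv x \<otimes> q) [^] ord x"
    using ord_class[OF x y] by (metis mem_carrier pow_ord_eq_1)
  also have "\<dots> = inv x [^] ord x \<otimes> q [^] ord x"
    using pow_mult_distrib[of "inv x" q] exotic_central[OF q, of "inv x"] x q by simp
  also have "\<dots> = q"
    using x q q_pow by (simp add: nat_pow_inv)
  finally have "q \<in> H"
    using q by (simp add: H_iff)
  with exotic_not_H[OF q] show False by simp
qed

text \<open>
Let \<open>x, y \<in> A\<close>.  If \<open>x y = q = x\<^sup>2\<close>, then \<open>y = x\<close>, and \<open>x y = 1\<close> is excluded by
\<open>exotic_inv_notin\<close>.  By \<open>exotic_square\<close> all of \<open>A\<close> and \<open>A\<inverse>\<close> squares to \<open>q\<close>, so \<open>(x y)\<^sup>2 = q = x\<^sup>2\<close> whenever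
\<open>x y \<in> A \<union> A\<inverse>\<close>.  This reads \<open>y x y = x\<close>, so \<open>y x y\<inverse> = x y\<^sup>-\<^sup>2 = x\<inverse>\<close>, and \<open>A\<close> would contain
\<open>x\<inverse>\<close>.  Hence \<open>A\<close> has only one element, which is of the form \<open>s t\<inverse> = 1\<close>.
\<close>
lemma exotic_empty: "exotic = {}"
proof (rule ccontr)
  assume "exotic \<noteq> {}"
  then obtain q where q: "q \<in> exotic" by blast
  have class_singleton: "y = x" if xy: "x \<in> A" "y \<in> A" for x y
  proof -
    have "x \<otimes> y \<in> H \<or> x \<otimes> y = q"
      using product_cases[OF xy] exotic_unique[OF q] by blast
    then consider "x \<otimes> y = q" | "x \<otimes> y = \<one>" | "x \<otimes> y \<in> A \<or> inv (x \<otimes> y) \<in> A"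
      by (auto simp: H_iff)
    then show ?thesis
    proof cases
      case 1
      then have "x \<otimes> y = x \<otimes> x"
        using exotic_square[OF q xy(1)] by simp
      then show ?thesis using xy by simp
    next
      case 2
      then have "inv y = x"
        using xy inv_equality by simp
      with exotic_inv_notin[OF q xy(2)] xy show ?thesis by simp
    next
      case 3
      have "inv q = q"
        using exotic_involution[OF q] q inv_equality by simp
      then have "(x \<otimes> y) \<otimes> (x \<otimes> y) = q"
        using 3 exotic_square[OF q] xy q
        by (metis inv_inv inv_mult_group m_closed mem_carrier)
      then have "x \<otimes> (y \<otimes> x \<otimes> y) = x \<otimes> x"
        using exotic_square[OF q xy(1)] xy by (simp add: m_assoc)
      then have yxy: "y \<otimes> x \<otimes> y = x"
        using xy by simp
      have "y \<otimes> x \<otimes> inv y = (y \<otimes> x \<otimes> y) \<otimes> inv (y \<otimes> y)"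
        using xy by (simp add: inv_mult_group m_assoc)
      also have "\<dots> = x \<otimes> inv (x \<otimes> x)"
        using yxy exotic_square[OF q] xy by metis
      also have "\<dots> = inv x"
        using xy by (simp add: inv_mult_group)
      finally have "inv x \<in> A"
        using conj_closed[of y x] xy by simp
      with exotic_inv_notin[OF q xy(1)] show ?thesis by simp
    qed
  qed
  obtain a where a: "a \<in> A"
    using nonempty by blast
  then have "a \<in> H"
    by (simp add: H_iff)
  then obtain s t where "s \<in> A" "t \<in> A" "a = s \<otimes> inv t"
    unfolding H_eq_quotients by blast
  then have "a = \<one>"
    using class_singleton[of s t] by simp
  with a exotic_one_notin[OF q] show False by simp
qed

section \<open>The subgroup generated by the class\<close>

lemma subgroup_H: "subgroup H G"
proof (rule subgroupI)
  show "H \<subseteq> carrier G" "H \<noteq> {}"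
    using H_iff by blast+
  show "inv a \<in> H" if "a \<in> H" for a
    using that by (auto simp: H_iff)
  have AA: "a \<otimes> b \<in> H" if "a \<in> A" "b \<in> A" for a b
    using product_cases[OF that] exotic_empty by simp
  have H_inv: "inv h \<in> H \<longleftrightarrow> h \<in> H" if "h \<in> carrier G" for h
    using that by (auto simp: H_iff)
  show "a \<otimes> b \<in> H" if ab: "a \<in> H" "b \<in> H" for a b
  proof -
    have carr: "a \<in> carrier G" "b \<in> carrier G"
      using ab by (auto simp: H_iff)
    consider "a = \<one> \<or> b = \<one>" | "a \<in> A" "b \<in> A" | "a \<in> A" "inv b \<in> A"
      | "inv a \<in> A" "b \<in> A" | "inv a \<in> A" "inv b \<in> A"
      using ab by (auto simp: H_iff)
    then show ?thesis
    proof cases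
      case 3
      then show ?thesis using quotient_in_H[of a "inv b"] carr by simp
    next
      case 4
      then show ?thesis
        by (rule left_quotient_cases) (use carr in \<open>auto simp: H_iff inv_mult_group\<close>)
    next
      case 5
      then show ?thesis
        using AA[of "inv b" "inv a"] H_inv[of "a \<otimes> b"] carr by (simp add: inv_mult_group)
    qed (use ab carr AA in auto)
  qed
qed

lemma generate_eq_H: "generate G A = H"
proof
  show "generate G A \<subseteq> H"
    by (rule generate_subgroup_incl[OF _ subgroup_H]) (auto simp: H_iff)
  show "H \<subseteq> generate G A"
  proof
    fix h assume "h \<in> H"
    then obtain a b where "a \<in> A" "b \<in> A" "h = a \<otimes> inv b"
      unfolding H_eq_quotients by blast
    then show "h \<in> generate G A"
      by (auto intro: generate.intros)
  qed
qed

text \<open>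
All nontrivial elements of \<open>H\<close> are conjugate up to inversion, so they share one order; a suitable
power of one of them has prime order, hence so do all.
\<close>
lemma exponent_prime_H: "\<exists>p::nat. prime p \<and> (\<forall>h\<in>H. h [^] p = \<one>)"
proof (cases "H = {\<one>}")
  case True
  then show ?thesis
    using two_is_prime_nat by auto
next
  case False
  then obtain x where x: "x \<in> H" "x \<noteq> \<one>"
    using subgroup.one_closed[OF subgroup_H] by blast
  have carr: "h \<in> carrier G" if "h \<in> H" for h
    using that by (simp add: H_iff)
  have ord_A: "\<exists>a\<in>A. ord h = ord a" if h: "h \<in> H" "h \<noteq> \<one>" for h
  proof (cases "h \<in> A")
    case False
    with h have "inv h \<in> A" "ord (inv h) = ord h"
      by (auto simp: H_iff)
    then show ?thesis by metis
  qed blast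
  have ord_H: "ord h = ord x" if "h \<in> H" "h \<noteq> \<one>" for h
    using ord_A[OF that] ord_A[OF x] ord_class by metis
  have "ord x \<noteq> 1"
    using x carr ord_eq_1 by blast
  then obtain p where p: "prime p" "p dvd ord x"
    using prime_factor_nat by blast
  then obtain k where k: "ord x = p * k" by blast
  have "ord x > 0"
    using ord_ge_1[OF fin carr[OF x(1)]] by simp
  then have "k > 0"
    using k by (cases k) auto
  have pow_H: "x [^] k \<in> H"
    by (induction k) (use x(1) subgroup_H in \<open>auto intro: subgroup.one_closed subgroup.m_closed\<close>)
  have "ord (x [^] k) = p"
    using ord_pow[OF carr[OF x(1)], of k] k \<open>k > 0\<close> by simp
  moreover from this have "x [^] k \<noteq> \<one>"
    using p(1) by auto
  ultimately have "ord x = p"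
    using ord_H[OF pow_H] by simp
  then have "h [^] p = \<one>" if "h \<in> H" for h
    using ord_H[OF that] carr[OF that] pow_ord_eq_1[of h] by (cases "h = \<one>") auto
  with p(1) show ?thesis by blast
qed

text \<open>
A nontrivial central element of the \<open>p\<close>-group \<open>H\<close> lies in \<open>A\<close> after possibly inverting it.  As \<open>H\<close> is
normal in the whole group, all conjugates of that element are central in \<open>H\<close>, and these make up
\<open>A\<close>, which generates \<open>H\<close>.
\<close>
lemma commute_H:
  assumes xy: "x \<in> H" "y \<in> H"
  shows "x \<otimes> y = y \<otimes> x"
proof (cases "H = {\<one>}")
  case True
  with xy show ?thesis by simp
next
  case False
  let ?K = "G\<lparr>carrier := H\<rparr>"
  interpret K: group ?K
    using subgroup_H by (rule subgroup_imp_group)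
  have carr: "h \<in> carrier G" if "h \<in> H" for h
    using that by (simp add: H_iff)
  have finK: "finite (carrier ?K)"
    using fin carr finite_subset[of H "carrier G"] by auto
  obtain p :: nat where p: "prime p" "\<forall>h\<in>H. h [^] p = \<one>"
    using exponent_prime_H by blast
  have "h [^]\<^bsub>?K\<^esub> p = \<one>\<^bsub>?K\<^esub>" if "h \<in> carrier ?K" for h
    using p(2) that nat_pow_consistent[of h p H] by simp
  then obtain n where "order ?K = p ^ n"
    using K.order_prime_power[OF finK p(1)] by blast
  then obtain z where z: "z \<in> H" "z \<noteq> \<one>" "\<forall>h\<in>H. h \<otimes> z = z \<otimes> h"
    using K.p_group_nontrivial_centre[OF finK _ p(1)] False by auto
  obtain c where c: "c \<in> A" "\<forall>h\<in>H. h \<otimes> c = c \<otimes> h"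
  proof (cases "z \<in> A")
    case True
    with z that show ?thesis by blast
  next
    case False
    then have "inv z \<in> A"
      using z by (simp add: H_iff)
    moreover have "h \<otimes> inv z = inv z \<otimes> h" if "h \<in> H" for h
      using z that carr by (metis inv_closed inv_solve_left inv_solve_right m_assoc m_closed)
    ultimately show ?thesis
      using that by blast
  qed
  \<comment> \<open>Conjugating the commutation relations of \<open>c\<close> moves them to every other element of the class.\<close>
  have central: "h \<otimes> a = a \<otimes> h" if a: "a \<in> A" and h: "h \<in> H" for a h
  proof -
    obtain g where g: "g \<in> carrier G" "a = g \<otimes> c \<otimes> inv g"
      using conj_transitive[OF c(1) a] by blast
    define k where "k = inv g \<otimes> h \<otimes> g"
    have kG: "k \<in> carrier G"
      using g h carr unfolding k_def by simp
    have h_eq: "h = g \<otimes> k \<otimes> inv g"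
      using g h carr unfolding k_def by (simp add: m_assoc)
    then have "k \<in> H"
      using H_conj[OF g(1) kG] h by simp
    then have kc: "k \<otimes> c = c \<otimes> k"
      using c(2) by blast
    have "h \<otimes> a = g \<otimes> (k \<otimes> c) \<otimes> inv g"
      unfolding h_eq g(2) using g(1) kG c(1) by (simp add: m_assoc)
    also have "\<dots> = a \<otimes> h"
      unfolding kc unfolding h_eq g(2) using g(1) kG c(1) by (simp add: m_assoc)
    finally show ?thesis .
  qed
  obtain a b where ab: "a \<in> A" "b \<in> A" "y = a \<otimes> inv b"
    using xy(2) unfolding H_eq_quotients by blast
  have "x \<otimes> inv b = inv b \<otimes> x"
    using central[OF ab(2) xy(1)] ab carr[OF xy(1)]
    by (metis inv_closed inv_solve_left inv_solve_right m_assoc m_closed mem_carrier)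
  then show ?thesis
    using central[OF ab(1) xy(1)] ab carr[OF xy(1)] by (metis inv_closed m_assoc mem_carrier)
qed

lemma elementary_abelian_H: "elementary_abelian (G\<lparr>carrier := H\<rparr>)"
  unfolding elementary_abelian_def
proof (intro conjI)
  interpret K: group "G\<lparr>carrier := H\<rparr>"
    using subgroup_H by (rule subgroup_imp_group)
  show "comm_group (G\<lparr>carrier := H\<rparr>)"
    by (rule K.group_comm_groupI) (simp add: commute_H)
  show "finite (carrier (G\<lparr>carrier := H\<rparr>))"
    using fin finite_subset subgroup.subset[OF subgroup_H] by auto
  show "\<exists>p::nat. prime p \<and> (\<forall>x\<in>carrier (G\<lparr>carrier := H\<rparr>).
      x [^]\<^bsub>G\<lparr>carrier := H\<rparr>\<^esub> p = \<one>\<^bsub>G\<lparr>carrier := H\<rparr>\<^esub>)"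
    using exponent_prime_H by (simp flip: nat_pow_consistent)
qed

end

theorem theoremC:
  fixes G :: "('a, 'b) monoid_scheme" and A :: "'a set"
  assumes "group G" and "finite (carrier G)"
    and "A \<in> conjugacy_classes G"
    and "A <#>\<^bsub>G\<^esub> (set_inv\<^bsub>G\<^esub> A) = {\<one>\<^bsub>G\<^esub>} \<union> A \<union> (set_inv\<^bsub>G\<^esub> A)"
  shows "generate G A = A <#>\<^bsub>G\<^esub> (set_inv\<^bsub>G\<^esub> A) \<and>
         elementary_abelian (G\<lparr>carrier := generate G A\<rparr>)"
proof -
  interpret group G by fact
  interpret small_quotient_class G A
    using assms conjugacy_class_subset conjugacy_class_nonempty conjugacy_class_conj_closed
      conjugacy_class_transitive by unfold_locales
  have "A <#>\<^bsub>G\<^esub> (set_inv\<^bsub>G\<^esub> A) = H"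
    unfolding H_def by (rule quotients)
  then show ?thesis
    using generate_eq_H elementary_abelian_H by simp
qed

end
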